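(* The space $\tilde{\mathbb{I}}$ with the order topology induced by the linear order $<_{\mathrm{XY}}$ is compact.
   Context: $\tilde{\mathbb{I}}=\{\langle\mu,\nu\rangle\in[0,1]^2 \mid \mu+\nu\le 1\}$ is the set of intuitionistic fuzzy values. For $\alpha=\langle\mu_\alpha,\nu_\alpha\rangle\in\tilde{\mathbb{I}}$ put $s(\alpha)=\mu_\alpha-\nu_\alpha$ and $h(\alpha)=\mu_\alpha+\nu_\alpha$. Define $\alpha<_{\mathrm{XY}}\beta$ iff $s(\alpha)<s(\beta)$, or $s(\alpha)=s(\beta)$ and $h(\alpha)<h(\beta)$. The order topology on a linearly ordered set $X$ has as a basis all intervals $(a,b)$, $(\leftarrow,b)=\{x: x<b\}$ and $(a,\rightarrow)=\{x: a<x\}$. A topological space is called compact if it is Hausdorff and every open cover has a finite subcover. *)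

theory Defs
  imports "HOL-Analysis.Analysis"
begin

typedef ifv = "{\<alpha> :: real \<times> real.
    0 \<le> fst \<alpha> \<and> fst \<alpha> \<le> 1 \<and> 0 \<le> snd \<alpha> \<and> snd \<alpha> \<le> 1 \<and> fst \<alpha> + snd \<alpha> \<le> 1}"
  morphisms pair_of_ifv Abs_ifv
  by (rule exI [where x = "(0, 0)"]) simp

definition mem_deg :: "ifv \<Rightarrow> real"
  where "mem_deg \<alpha> = fst (pair_of_ifv \<alpha>)"

definition nonmem_deg :: "ifv \<Rightarrow> real"
  where "nonmem_deg \<alpha> = snd (pair_of_ifv \<alpha>)"

definition score :: "ifv \<Rightarrow> real"
  where "score \<alpha> = mem_deg \<alpha> - nonmem_deg \<alpha>"

definition accuracy :: "ifv \<Rightarrow> real"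
  where "accuracy \<alpha> = mem_deg \<alpha> + nonmem_deg \<alpha>"

lemma score_accuracy_eq_imp_eq:
  assumes "score \<alpha> = score \<beta>" "accuracy \<alpha> = accuracy \<beta>"
  shows "\<alpha> = \<beta>"
proof -
  have "pair_of_ifv \<alpha> = pair_of_ifv \<beta>"
    using assms
    by (intro prod_eqI) (auto simp: score_def accuracy_def mem_deg_def nonmem_deg_def)
  then show ?thesis by (simp add: pair_of_ifv_inject)
qed

text \<open>The order of the class instance is the strict Xu--Yager order \<open><\<^sub>X\<^sub>Y\<close> and its reflexive closure.\<close>

instantiation ifv :: linorder
begin

definition less_ifv :: "ifv \<Rightarrow> ifv \<Rightarrow> bool"
  where "\<alpha> < \<beta> \<longleftrightarrow>
    score \<alpha> < score \<beta> \<or> (score \<alpha> = score \<beta> \<and> accuracy \<alpha> < accuracy \<beta>)"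

definition less_eq_ifv :: "ifv \<Rightarrow> ifv \<Rightarrow> bool"
  where "\<alpha> \<le> \<beta> \<longleftrightarrow> \<alpha> < \<beta> \<or> \<alpha> = (\<beta> :: ifv)"

instance
proof
  fix x y z :: ifv
  show "x < y \<longleftrightarrow> x \<le> y \<and> \<not> y \<le> x"
    by (auto simp: less_eq_ifv_def less_ifv_def)
  show "x \<le> x"
    by (simp add: less_eq_ifv_def)
  show "x \<le> y \<Longrightarrow> y \<le> z \<Longrightarrow> x \<le> z"
    by (auto simp: less_eq_ifv_def less_ifv_def)
  show "x \<le> y \<Longrightarrow> y \<le> x \<Longrightarrow> x = y"
    by (auto simp: less_eq_ifv_def less_ifv_def)
  show "x \<le> y \<or> y \<le> x"
    using score_accuracy_eq_imp_eq [of x y]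
    unfolding less_eq_ifv_def less_ifv_def by argo
qed

end

instantiation ifv :: linorder_topology
begin

definition open_ifv :: "ifv set \<Rightarrow> bool"
  where "open_ifv = generate_topology (range (\<lambda>a. {..<a}) \<union> range (\<lambda>a. {a<..}))"

instance
  by standard (rule open_ifv_def)

end

text \<open>
  The library generates the order topology from the open rays as a subbasis.
  The open intervals and the open rays together form a basis of the same topology.
\<close>

lemma ifv_order_basis:
  "topological_basis
    (range (\<lambda>(a, b). {a<..<b}) \<union> range (\<lambda>b. {..<b}) \<union> range (\<lambda>a. {a<..}) :: ifv set set)"
  (is "topological_basis ?B")
proof (rule topological_basisI)
  fix B :: "ifv set"
  assume "B \<in> ?B"
  then show "open B" by auto
next
  have Int: "A \<inter> B \<in> ?B" if "A \<in> ?B" "B \<in> ?B" for A B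
  proof -
    define I where "I = (\<lambda>(a :: ifv, b :: ifv). {a<..<b})"
    have I: "{a<..<b} \<in> range I" for a b
      by (auto simp: I_def intro!: image_eqI [of _ _ "(a, b)"])
    have "{a<..<b} \<inter> {c<..<d} = {max a c<..<min b d}"
      and "{a<..<b} \<inter> {..<d} = {a<..<min b d}"
      and "{..<d} \<inter> {a<..<b} = {a<..<min b d}"
      and "{a<..<b} \<inter> {c<..} = {max a c<..<b}"
      and "{c<..} \<inter> {a<..<b} = {max a c<..<b}"
      and "{..<b} \<inter> {..<d} = {..<min b d}"
      and "{..<b} \<inter> {c<..} = {c<..<b}"
      and "{c<..} \<inter> {..<b} = {c<..<b}"
      and "{a<..} \<inter> {c<..} = {max a c<..}" for a b c d :: ifv
      by auto
    note eqs = this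
    have "A \<inter> B \<in> range I \<union> range (\<lambda>b. {..<b}) \<union> range (\<lambda>a. {a<..})"
      using that by (elim UnE rangeE) (auto simp: eqs I)
    then show ?thesis by (simp add: I_def)
  qed
  have cover: "\<exists>B\<in>?B. x \<in> B" for x :: ifv
  proof -
    have "pair_of_ifv (Abs_ifv (0, 0)) \<noteq> pair_of_ifv (Abs_ifv (1, 0))"
      by (simp add: Abs_ifv_inverse)
    then obtain y where "y \<noteq> x" by metis
    then have "x \<in> {..<y} \<or> x \<in> {y<..}" by auto
    then show ?thesis by blast
  qed
  fix U :: "ifv set" and x
  assume "open U" "x \<in> U"
  from \<open>open U\<close>
  have "generate_topology (range (\<lambda>a. {..<a}) \<union> range (\<lambda>a. {a<..})) U"
    by (simp add: open_ifv_def)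
  then show "\<exists>B\<in>?B. x \<in> B \<and> B \<subseteq> U"
    using \<open>x \<in> U\<close>
  proof (induction rule: generate_topology.induct)
    case UNIV
    then show ?case using cover by auto
  next
    case (Int U V)
    then obtain A B where "A \<in> ?B" "x \<in> A" "A \<subseteq> U" "B \<in> ?B" "x \<in> B" "B \<subseteq> V"
      by (meson IntD1 IntD2)
    then show ?case
      using \<open>\<And>A B. A \<in> ?B \<Longrightarrow> B \<in> ?B \<Longrightarrow> A \<inter> B \<in> ?B\<close> [of A B]
      by (intro bexI [of _ "A \<inter> B"]) auto
  next
    case (UN K)
    then obtain k where "k \<in> K" "x \<in> k" by blast
    with UN.IH [of k] show ?case by (meson Union_upper subset_trans)
  next
    case (Basis S)
    then show ?case by blast
  qed
qed

end

(* A linearly ordered set in which every subset has a least upper bound is compact in its order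
   topology. In the Xu--Yager order, which is lexicographic in score and accuracy, the least upper
   bound of a set has as score the supremum s of the scores; its accuracy is the supremum of the
   accuracies over the members of score s, or the least admissible accuracy, the absolute value of s,
   if the supremum of the scores is not attained. *)

theory Submission
  imports Defs
begin

text \<open>The points whose initial segment is finitely covered form a set \<open>S\<close>. Its
  least upper bound \<open>t\<close> lies in \<open>S\<close>, and no point lies above
  \<open>t\<close>, so \<open>{..t}\<close> is the whole space.\<close>

lemma compact_UNIV_of_lub:
  assumes lub: "\<And>S :: 'a :: linorder_topology set.
    \<exists>t. (\<forall>x\<in>S. x \<le> t) \<and> (\<forall>u. (\<forall>x\<in>S. x \<le> u) \<longrightarrow> t \<le> u)"
  shows "compact (UNIV :: 'a set)"
proof (rule compactI)
  fix C :: "'a set set"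
  assume op: "\<forall>U\<in>C. open U" and cov: "UNIV \<subseteq> \<Union>C"
  define S where "S = {x. \<exists>D\<subseteq>C. finite D \<and> {..x} \<subseteq> \<Union>D}"
  have ext: "z \<in> S" if "y \<in> S" "V \<in> C" "W \<in> C" "{..z} \<subseteq> {..y} \<union> V \<union> W" for y z V W
  proof -
    from that(1) obtain D where "D \<subseteq> C" "finite D" "{..y} \<subseteq> \<Union>D"
      by (auto simp: S_def)
    then have "insert V (insert W D) \<subseteq> C" "finite (insert V (insert W D))"
      "{..z} \<subseteq> \<Union>(insert V (insert W D))"
      using that by auto
    then show ?thesis unfolding S_def by blast
  qed
  obtain t where t: "\<And>x. x \<in> S \<Longrightarrow> x \<le> t" "\<And>u. (\<And>x. x \<in> S \<Longrightarrow> x \<le> u) \<Longrightarrow> t \<le> u"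
    using lub [of S] by blast
  obtain U where U: "U \<in> C" "t \<in> U" "open U" using cov op by blast
  have tS: "t \<in> S"
  proof (cases "\<exists>a. a < t")
    case True
    then obtain a where a: "a < t" "{a<..t} \<subseteq> U"
      using open_left [OF U(3,2)] by blast
    then obtain y where y: "y \<in> S" "a < y"
      \<comment> \<open>Otherwise \<open>a\<close> would bound \<open>S\<close> and give
        \<open>t\<close> \<le> \<open>a\<close>. This also excludes an empty \<open>S\<close>, whose
        least upper bound is the least element.\<close>
      using t(2) [of a] by (meson not_le)
    then have "{..t} \<subseteq> {..y} \<union> {a<..t}" by (auto simp: not_le)
    then have "{..t} \<subseteq> {..y} \<union> U \<union> U" using a(2) by blast
    then show ?thesis using ext y(1) U(1) by blast
  next
    \<comment> \<open>Here \<open>t\<close> is the least element, so \<open>{..t}\<close> is a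
      single point.\<close>
    case False
    then have "{..t} \<subseteq> U" using U(2) by (auto simp: order.order_iff_strict)
    then have "{U} \<subseteq> C \<and> finite {U} \<and> {..t} \<subseteq> \<Union>{U}" using U(1) by simp
    then show ?thesis unfolding S_def by blast
  qed
  have "\<not> t < w" for w
  proof
    assume "t < w"
    then obtain b where b: "t < b" "{t..<b} \<subseteq> U"
      using open_right [OF U(3,2)] by blast
    \<comment> \<open>\<open>U\<close> need not contain \<open>b\<close>; a second member of the
      cover takes care of it and brings a point above \<open>t\<close> into
      \<open>S\<close>.\<close>
    obtain W where W: "W \<in> C" "b \<in> W" using cov by blast
    have "{..b} \<subseteq> {..t} \<union> {t..<b} \<union> {b}" by (auto simp: le_less)
    then have "{..b} \<subseteq> {..t} \<union> U \<union> W" using b(2) W(2) by blast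
    then have "b \<in> S" using ext tS U(1) W(1) by blast
    then show False using t(1) b(1) by force
  qed
  then have "{..t} = UNIV" by (auto simp: not_less)
  then show "\<exists>D\<subseteq>C. finite D \<and> UNIV \<subseteq> \<Union>D"
    using tS unfolding S_def by auto
qed

lemma ifv_bounds:
  "- 1 \<le> score \<alpha>" "score \<alpha> \<le> 1" "\<bar>score \<alpha>\<bar> \<le> accuracy \<alpha>" "accuracy \<alpha> \<le> 1"
  using pair_of_ifv [of \<alpha>]
  by (auto simp: score_def accuracy_def mem_deg_def nonmem_deg_def)

text \<open>Membership (h + s)/2 and non-membership (h - s)/2 invert the linear change of
  coordinates. The hypotheses say exactly that this pair is admissible.\<close>

lemma ifv_of_score_accuracy:
  assumes "\<bar>s\<bar> \<le> h" "h \<le> 1"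
  obtains \<alpha> where "score \<alpha> = s" "accuracy \<alpha> = h"
proof
  have "pair_of_ifv (Abs_ifv ((h + s) / 2, (h - s) / 2)) = ((h + s) / 2, (h - s) / 2)"
    using assms by (intro Abs_ifv_inverse) (auto simp: field_simps)
  then show "score (Abs_ifv ((h + s) / 2, (h - s) / 2)) = s"
    and "accuracy (Abs_ifv ((h + s) / 2, (h - s) / 2)) = h"
    by (auto simp: score_def accuracy_def mem_deg_def nonmem_deg_def field_simps)
qed

lemma ifv_le_iff:
  "\<alpha> \<le> \<beta> \<longleftrightarrow> score \<alpha> < score \<beta> \<or> score \<alpha> = score \<beta> \<and> accuracy \<alpha> \<le> accuracy \<beta>"
  unfolding less_eq_ifv_def less_ifv_def
  using score_accuracy_eq_imp_eq [of \<alpha> \<beta>] by (auto simp: le_less)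

lemma ifv_lub_exists:
  fixes S :: "ifv set"
  shows "\<exists>t. (\<forall>x\<in>S. x \<le> t) \<and> (\<forall>u. (\<forall>x\<in>S. x \<le> u) \<longrightarrow> t \<le> u)"
proof (cases "S = {}")
  case True
  \<comment> \<open>The least upper bound of the empty set is the least element \<langle>0,
    1\<rangle>: score -1 forces accuracy 1.\<close>
  obtain t where "score t = - 1" "accuracy t = 1"
    by (rule ifv_of_score_accuracy [of "- 1" 1]) auto
  then have "t \<le> u" for u
    using ifv_bounds [of u] by (auto simp: ifv_le_iff)
  with True show ?thesis by auto
next
  case False
  define s where "s = Sup (score ` S)"
  have bdd: "bdd_above (score ` S)" using ifv_bounds by (auto intro!: bdd_aboveI [of _ 1])
  have up: "score x \<le> s" if "x \<in> S" for x
    unfolding s_def using that bdd by (intro cSup_upper) auto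
  have least: "s \<le> c" if "\<And>x. x \<in> S \<Longrightarrow> score x \<le> c" for c
    unfolding s_def using that False by (intro cSup_least) auto
  have s: "\<bar>s\<bar> \<le> 1"
  proof -
    obtain x where "x \<in> S" using False by blast
    then show ?thesis using up [of x] ifv_bounds(1) [of x] least [of 1] ifv_bounds(2) by force
  qed
  define F where "F = {x \<in> S. score x = s}"
  show ?thesis
  proof (cases "F = {}")
    case True
    then have lt: "score x < s" if "x \<in> S" for x
      using up [OF that] that by (force simp: F_def)
    obtain t where t: "score t = s" "accuracy t = \<bar>s\<bar>"
      using ifv_of_score_accuracy [of s "\<bar>s\<bar>"] s by auto
    have "t \<le> u" if "\<And>x. x \<in> S \<Longrightarrow> x \<le> u" for u
    proof -
      \<comment> \<open>If equality holds here, the accuracy of \<open>u\<close> is still at least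
        \<bar>s\<bar>, the accuracy of \<open>t\<close>.\<close>
      have "s \<le> score u" using that by (intro least) (force simp: ifv_le_iff)
      then show ?thesis using ifv_bounds(3) [of u] by (auto simp: ifv_le_iff t)
    qed
    then show ?thesis using lt by (intro exI [of _ t]) (auto simp: ifv_le_iff t)
  next
    case False
    define h where "h = Sup (accuracy ` F)"
    have bddF: "bdd_above (accuracy ` F)" using ifv_bounds by (auto intro!: bdd_aboveI [of _ 1])
    have upF: "accuracy x \<le> h" if "x \<in> F" for x
      unfolding h_def using that bddF by (intro cSup_upper) auto
    have leastF: "h \<le> c" if "\<And>x. x \<in> F \<Longrightarrow> accuracy x \<le> c" for c
      unfolding h_def using that False by (intro cSup_least) auto
    obtain y where y: "y \<in> F" using False by blast
    then have "\<bar>s\<bar> \<le> h" using upF [of y] ifv_bounds(3) [of y] by (auto simp: F_def)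
    moreover have "h \<le> 1" using ifv_bounds by (intro leastF) auto
    ultimately obtain t where t: "score t = s" "accuracy t = h"
      using ifv_of_score_accuracy by blast
    have "x \<le> t" if "x \<in> S" for x
      using up [OF that] upF [of x] that by (auto simp: ifv_le_iff t F_def)
    moreover have "t \<le> u" if u: "\<And>x. x \<in> S \<Longrightarrow> x \<le> u" for u
    proof -
      have "s \<le> score u" using u [of y] y by (auto simp: ifv_le_iff F_def)
      \<comment> \<open>Accuracies matter only for a tie in score, and then \<open>u\<close> bounds
        the accuracies over \<open>F\<close>.\<close>
      moreover have "h \<le> accuracy u" if "score u = s"
        using u that by (intro leastF) (force simp: ifv_le_iff F_def)
      ultimately show ?thesis by (auto simp: ifv_le_iff t)
    qed
    ultimately show ?thesis by blast
  qed
qed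

theorem proposition5p1:
  "Hausdorff_space (euclidean :: ifv topology) \<and> compact_space (euclidean :: ifv topology)"
proof
  \<comment> \<open>Every order topology of a linear order is Hausdorff.\<close>
  show "Hausdorff_space (euclidean :: ifv topology)"
    unfolding Hausdorff_space_def disjnt_def using hausdorff by auto
  show "compact_space (euclidean :: ifv topology)"
    using compact_UNIV_of_lub [OF ifv_lub_exists] by (simp add: compact_space_def)
qed

end
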